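(* Let $n$ be a positive integer. Then there exists a reduced cancellative monoid $H$ such that $\#\mathcal{S}(H)=n$.
   Context: All monoids are commutative. A monoid $H$ is reduced if its only invertible element is the identity. Writing $H$ multiplicatively, an element $a\in H$ is square-free if it cannot be written as $a=b^2c$ with $b,c\in H$ and $b$ non-invertible; $\mathcal{S}(H)$ is the set of square-free elements of $H$ (including the identity), and $\#\mathcal{S}(H)$ is its cardinality. *)

theory Defs
  imports "HOL-Algebra.Divisibility"
begin

definition reduced_monoid :: "('a, 'b) monoid_scheme \<Rightarrow> bool" where
  "reduced_monoid H \<longleftrightarrow> Units H = {\<one>\<^bsub>H\<^esub>}"

definition square_free_elem :: "('a, 'b) monoid_scheme \<Rightarrow> 'a \<Rightarrow> bool" where
  "square_free_elem H a \<longleftrightarrow>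
     a \<in> carrier H \<and>
     \<not> (\<exists>b\<in>carrier H. \<exists>c\<in>carrier H. b \<notin> Units H \<and> a = b [^]\<^bsub>H\<^esub> (2::nat) \<otimes>\<^bsub>H\<^esub> c)"

definition square_free_elems :: "('a, 'b) monoid_scheme \<Rightarrow> 'a set" where
  "square_free_elems H = {a. square_free_elem H a}"

end

theory Submission
  imports Defs "HOL-Library.Countable"
begin

text \<open>
  Let the rational height of a nonzero residue class modulo \<open>n\<close> be at least 1, and that of the zero
  class at least 0; the pairs of a class and an admissible height form a monoid. A pair whose height
  is not minimal is divisible by some \<open>(0, e)\<close> with \<open>e > 0\<close>, and \<open>(0, e)\<close> is the double of
  \<open>(0, e / 2)\<close>. A pair of minimal height is square-free: its height is at most 1, so a
  non-invertible \<open>b\<close> whose double divides it must be some \<open>(0, e)\<close>, and removing that would push the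
  height of the class below its minimum. So each class contains exactly one square-free element.
\<close>

text \<open>Transport of structure: when \<open>f\<close> is injective on the carrier, this is an
  isomorphic copy of \<open>M\<close> on another type. It serves to move the final example onto
  \<open>nat\<close>.\<close>

definition image_monoid :: "('a \<Rightarrow> 'b) \<Rightarrow> 'a monoid \<Rightarrow> 'b monoid" where
  "image_monoid f M =
     \<lparr>carrier = f ` carrier M,
      mult = (\<lambda>x y. f (inv_into (carrier M) f x \<otimes>\<^bsub>M\<^esub> inv_into (carrier M) f y)),
      one = f \<one>\<^bsub>M\<^esub>\<rparr>"

lemma carrier_image_monoid [simp]: "carrier (image_monoid f M) = f ` carrier M"
  and one_image_monoid [simp]: "\<one>\<^bsub>image_monoid f M\<^esub> = f \<one>\<^bsub>M\<^esub>"
  by (simp_all add: image_monoid_def)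

lemma mult_image_monoid [simp]:
  assumes "inj_on f (carrier M)" "x \<in> carrier M" "y \<in> carrier M"
  shows "f x \<otimes>\<^bsub>image_monoid f M\<^esub> f y = f (x \<otimes>\<^bsub>M\<^esub> y)"
  using assms by (simp add: image_monoid_def)

lemma comm_monoid_cancel_image_monoid:
  assumes "comm_monoid_cancel M" and inj: "inj_on f (carrier M)"
  shows "comm_monoid_cancel (image_monoid f M)"
proof -
  interpret comm_monoid_cancel M by fact
  have "comm_monoid (image_monoid f M)"
    by (rule comm_monoidI) (auto simp: inj m_assoc intro: arg_cong[OF m_comm])
  then show ?thesis
    by (rule comm_monoid_cancelI) (auto simp: inj inj_on_eq_iff[OF inj] intro: r_cancel)
qed

lemma Units_image_monoid:
  assumes "comm_monoid M" and inj: "inj_on f (carrier M)"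
  shows "Units (image_monoid f M) = f ` Units M"
proof -
  interpret comm_monoid M by fact
  show ?thesis
    unfolding Units_def by (auto simp: inj inj_on_eq_iff[OF inj] intro!: imageI)
qed

lemma (in monoid) square_free_elem_iff:
  "square_free_elem G a \<longleftrightarrow>
     a \<in> carrier G \<and> (\<forall>b\<in>carrier G. \<forall>c\<in>carrier G. a = b \<otimes> b \<otimes> c \<longrightarrow> b \<in> Units G)"
  by (auto simp: square_free_elem_def numeral_2_eq_2)

lemma square_free_elems_image_monoid:
  assumes "comm_monoid_cancel M" and inj: "inj_on f (carrier M)"
  shows "square_free_elems (image_monoid f M) = f ` square_free_elems M"
proof -
  interpret M: comm_monoid_cancel M by fact
  interpret N: comm_monoid_cancel "image_monoid f M"
    by (rule comm_monoid_cancel_image_monoid) fact+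
  \<comment> \<open>Units lie in the carrier, so injectivity there is enough for the image to
    reflect being a unit.\<close>
  have "f b \<in> f ` Units M \<longleftrightarrow> b \<in> Units M" if "b \<in> carrier M" for b
    using that by (intro inj_on_image_mem_iff[OF inj]) auto
  then have "square_free_elem (image_monoid f M) (f a) \<longleftrightarrow> square_free_elem M a"
    if "a \<in> carrier M" for a
    using that
    by (auto simp: N.square_free_elem_iff M.square_free_elem_iff inj inj_on_eq_iff[OF inj]
        Units_image_monoid[OF M.comm_monoid_axioms inj])
  then show ?thesis
    by (auto simp: square_free_elems_def N.square_free_elem_iff M.square_free_elem_iff)
qed

definition min_height :: "nat \<Rightarrow> rat" where
  "min_height v = (if v = 0 then 0 else 1)"

lemma min_height_0 [simp]: "min_height 0 = 0"
  and min_height_pos: "v \<noteq> 0 \<Longrightarrow> min_height v = 1"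
  and min_height_nonneg: "0 \<le> min_height v"
  by (simp_all add: min_height_def)

text \<open>If both classes are zero, so is their sum; otherwise the right side is already at least
  1. This subadditivity makes the admissible pairs closed under addition.\<close>

lemma min_height_add_mod: "min_height ((v + w) mod n) \<le> min_height v + min_height w"
  by (auto simp: min_height_def)

text \<open>Rational heights can be halved, and they keep the carrier countable, so that it can be
  encoded in \<open>nat\<close>.\<close>

definition height_monoid :: "nat \<Rightarrow> (nat \<times> rat) monoid" where
  "height_monoid n =
     \<lparr>carrier = {(v, q). v < n \<and> min_height v \<le> q},
      mult = (\<lambda>(v, q) (w, r). ((v + w) mod n, q + r)),
      one = (0, 0)\<rparr>"

lemma carrier_height_monoid [simp]:
    "(v, q) \<in> carrier (height_monoid n) \<longleftrightarrow> v < n \<and> min_height v \<le> q"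
  and mult_height_monoid [simp]:
    "(v, q) \<otimes>\<^bsub>height_monoid n\<^esub> (w, r) = ((v + w) mod n, q + r)"
  and one_height_monoid [simp]: "\<one>\<^bsub>height_monoid n\<^esub> = (0, 0)"
  by (simp_all add: height_monoid_def)

lemma add_mod_right_cancel:
  fixes u v w n :: nat
  assumes "(u + w) mod n = (v + w) mod n" "u < n" "v < n"
  shows "u = v"
proof -
  \<comment> \<open>Multiples of \<open>n\<close> on both sides avoid truncated subtraction, and
    \<open>w\<close> cancels before reducing again.\<close>
  obtain i j where "u + w + n * i = v + w + n * j"
    using assms(1) by (auto simp: nat_mod_eq_iff)
  then have "(u + n * i) mod n = (v + n * j) mod n" by simp
  with assms(2,3) show ?thesis by simp
qed

lemma comm_monoid_cancel_height_monoid: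
  assumes "n > 0"
  shows "comm_monoid_cancel (height_monoid n)"
proof -
  have closed: "min_height ((v + w) mod n) \<le> q + r"
    if "min_height v \<le> q" "min_height w \<le> r" for v w q r
    using that min_height_add_mod[of v w n] by linarith
  have "comm_monoid (height_monoid n)"
    by (rule comm_monoidI)
      (auto simp: assms closed mod_add_left_eq mod_add_right_eq add_ac)
  then show ?thesis
    by (rule comm_monoid_cancelI) (auto dest: add_mod_right_cancel)
qed

text \<open>Heights are nonnegative, so two that sum to 0 both vanish, and only the zero class
  admits height 0.\<close>

lemma Units_height_monoid:
  assumes "n > 0"
  shows "Units (height_monoid n) = {(0, 0)}"
proof -
  interpret comm_monoid_cancel "height_monoid n"
    using assms by (rule comm_monoid_cancel_height_monoid)
  have "(v, q) = (0, 0)" if "(v, q) \<in> Units (height_monoid n)" for v q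
  proof -
    from that obtain w r where "min_height v \<le> q" "min_height w \<le> r" "q + r = 0"
      by (auto simp: Units_def)
    with min_height_nonneg[of v] min_height_nonneg[of w] have "q = 0" "min_height v \<le> 0"
      by linarith+
    then show ?thesis by (simp add: min_height_def split: if_splits)
  qed
  moreover have "(0, 0) \<in> Units (height_monoid n)"
    using Units_one_closed by simp
  ultimately show ?thesis by auto
qed

lemma square_free_elems_height_monoid:
  assumes "n > 0"
  shows "square_free_elems (height_monoid n) = (\<lambda>v. (v, min_height v)) ` {..<n}"
proof -
  interpret comm_monoid_cancel "height_monoid n"
    using assms by (rule comm_monoid_cancel_height_monoid)
  note sqf = square_free_elem_iff Units_height_monoid[OF assms]
  have minimal: "q = min_height v" "v < n" if sf: "square_free_elem (height_monoid n) (v, q)" for v q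
  proof -
    from sf show v: "v < n" by (simp add: sqf)
    from sf have q: "min_height v \<le> q" by (simp add: sqf)
    \<comment> \<open>Half of the excess height, placed in the zero class: square-freeness forces
      \<open>?b\<close> to be a unit, so the excess is 0.\<close>
    let ?b = "(0, (q - min_height v) / 2)" and ?c = "(v, min_height v)"
    have "(v, q) = ?b \<otimes>\<^bsub>height_monoid n\<^esub> ?b \<otimes>\<^bsub>height_monoid n\<^esub> ?c"
      using v by simp
    moreover have "?b \<in> carrier (height_monoid n)" "?c \<in> carrier (height_monoid n)"
      using v q by simp_all
    ultimately have "?b = (0, 0)"
      using sf unfolding sqf by blast
    then show "q = min_height v" by simp
  qed
  have square_free: "square_free_elem (height_monoid n) (v, min_height v)" if v: "v < n" for v
    unfolding sqf
  proof (intro conjI ballI impI)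
    show "(v, min_height v) \<in> carrier (height_monoid n)" using v by simp
  next
    fix b c
    assume b: "b \<in> carrier (height_monoid n)" and c: "c \<in> carrier (height_monoid n)"
      and eq: "(v, min_height v) = b \<otimes>\<^bsub>height_monoid n\<^esub> b \<otimes>\<^bsub>height_monoid n\<^esub> c"
    obtain w r u s where [simp]: "b = (w, r)" "c = (u, s)" by (cases b, cases c)
    have r: "min_height w \<le> r" and s: "min_height u \<le> s" and u: "u < n"
      using b c by simp_all
    have height: "min_height v = r + r + s" using arg_cong[OF eq, of snd] by simp
    have "min_height v \<le> 1" by (simp add: min_height_def)
    \<comment> \<open>For \<open>w \<noteq> 0\<close> the height \<open>r + r + s\<close> would be
      at least 2.\<close>
    with r s height min_height_nonneg[of u] min_height_pos[of w] have w: "w = 0" by linarith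
    with u have "v = u" using arg_cong[OF eq, of fst] by simp
    \<comment> \<open>Since \<open>v = u\<close>, the cofactor has height \<open>s\<close> at least
      \<open>min_height v = r + r + s\<close>, which leaves no room for a positive
      \<open>r\<close>.\<close>
    with w r s height have "r = 0" by simp
    with w show "b \<in> {(0, 0)}" by simp
  qed
  show ?thesis
    using minimal square_free by (auto simp: square_free_elems_def)
qed

theorem theorem9p1:
  fixes n :: nat
  assumes "n > 0"
  shows "\<exists>H :: nat monoid. comm_monoid_cancel H \<and> reduced_monoid H \<and>
           finite (square_free_elems H) \<and> card (square_free_elems H) = n"
proof (intro exI conjI)
  let ?M = "height_monoid n" and ?H = "image_monoid to_nat (height_monoid n) :: nat monoid"
  have M: "comm_monoid_cancel ?M"
    using assms by (rule comm_monoid_cancel_height_monoid)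
  have inj: "inj_on (to_nat :: nat \<times> rat \<Rightarrow> nat) A" for A
    by (rule inj_on_subset[OF inj_to_nat]) simp
  show "comm_monoid_cancel ?H"
    using M inj by (rule comm_monoid_cancel_image_monoid)
  show "reduced_monoid ?H"
    using M by (simp add: reduced_monoid_def Units_image_monoid inj Units_height_monoid assms
        comm_monoid_cancel.axioms)
  have S: "square_free_elems ?H = to_nat ` (\<lambda>v. (v, min_height v)) ` {..<n}"
    by (simp add: square_free_elems_image_monoid[OF M inj] square_free_elems_height_monoid assms)
  show "finite (square_free_elems ?H)"
    by (simp add: S)
  \<comment> \<open>The first coordinate tells the classes apart, so the \<open>n\<close> classes
    give \<open>n\<close> elements.\<close>
  have "inj_on (\<lambda>v. (v, min_height v)) {..<n}"
    by (simp add: inj_on_def)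
  then show "card (square_free_elems ?H) = n"
    by (simp add: S card_image inj)
qed

end
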